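(* Let $ABC$ be a (nondegenerate) triangle in the Euclidean plane, let $r,s,t$ be independent random variables uniformly distributed on $[0,1]$, and let $R = B + r\,\overrightarrow{BC}$, $S = C + s\,\overrightarrow{CA}$, $T = A + t\,\overrightarrow{AB}$. Let $Q = |\Delta RST|/|\Delta ABC|$. Then for every integer $n \ge 1$ the $n$-th moment $\mu_n = E[Q^n]$ is $$\mu_n = \sum_{k=0}^{n}\frac{n!}{k!(n-k)!}\left(\frac{(n-k)!\,k!}{(n+1)!}\right)^3 = \frac{1}{(n+1)\,((n+1)!)^2}\sum_{k=0}^{n}((n-k)!)^2\,(k!)^2,$$ and therefore $E\big[|\Delta RST|^n\big] = \mu_n\,|\Delta ABC|^n$.
   Context: $|\Delta XYZ|$ denotes the signed area of the triangle $XYZ$ (sign determined by the orientation of the ordered triple of vertices). $E$ denotes expectation. *)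

theory Defs
  imports "HOL-Probability.Probability"
begin

text \<open>
  Orientation of the ordered triple \<open>(X, Y, Z)\<close>: \<open>1\<close> if it is counterclockwise, \<open>-1\<close> if it is
  clockwise and \<open>0\<close> if the points are collinear.
\<close>

definition orientation :: "real^2 \<Rightarrow> real^2 \<Rightarrow> real^2 \<Rightarrow> real" where
  "orientation X Y Z = sgn (det (vector [Y - X, Z - X] :: real^2^2))"

definition signed_area :: "real^2 \<Rightarrow> real^2 \<Rightarrow> real^2 \<Rightarrow> real" where
  "signed_area X Y Z = orientation X Y Z * measure lborel (convex hull {X, Y, Z})"

lemma signed_area_eq_det:
  "signed_area X Y Z = det (vector [Y - X, Z - X] :: real^2^2) / 2"
proof -
  have "measure lborel (convex hull {X, Y, Z}) = \<bar>det (vector [Y - X, Z - X] :: real^2^2)\<bar> / 2"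
    unfolding content_triangle
    by (simp add: det_2 abs_minus_commute algebra_simps)
  then show ?thesis
    unfolding signed_area_def orientation_def
    by (simp only: times_divide_eq_right sgn_mult_abs)
qed

end

theory Submission
  imports Defs
begin

text \<open>
  Points on the three sides of a triangle span a signed area that is polynomial in
  the three parameters: relative to \<open>A B C\<close>, the triangle \<open>R S T\<close> has signed area
  \<open>r s t + (1 - r) (1 - s) (1 - t)\<close> (\<open>signed_area_points_on_sides\<close>), because this is the
  determinant of the barycentric coordinates of its vertices and the two nonzero terms in the
  expansion are the two cyclic products. Both terms separate the variables, so the binomial theorem
  writes the \<open>n\<close>-th power as a combination, with weights \<open>n choose k\<close>, of products of
  \<open>x ^ k * (1 - x) ^ (n - k)\<close> over \<open>x = r, s, t\<close>. By independence the expectation of such a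
  product is the cube of the expectation for a single uniform variable, and that is the Beta
  integral \<open>k! (n - k)! / (n + 1)!\<close> (\<open>moment_uniform_01\<close>).

  The quotient by the area of \<open>A B C\<close> makes sense because a triangle of zero signed area is
  degenerate (\<open>det_eq_0_imp_collinear\<close>).
\<close>

text \<open>
  By Lagrange's identity \<open>(u \<bullet> v)\<^sup>2 + det (u, v)\<^sup>2 = (norm u)\<^sup>2 (norm v)\<^sup>2\<close>, a vanishing
  determinant is the equality case of the Cauchy-Schwarz inequality.
\<close>

lemma det_eq_0_imp_collinear:
  fixes X Y Z :: "real^2"
  assumes "det (vector [Y - X, Z - X] :: real^2^2) = 0"
  shows "collinear {X, Y, Z}"
proof -
  let ?u = "Y - X" and ?v = "Z - X"
  have "?u$1 * ?v$2 - ?u$2 * ?v$1 = 0"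
    using assms by (simp add: det_2)
  then have "(?u \<bullet> ?v)\<^sup>2 = (?u \<bullet> ?u) * (?v \<bullet> ?v)"
    unfolding inner_vec_def sum_2 inner_real_def by algebra
  then have "\<bar>?u \<bullet> ?v\<bar> = norm ?u * norm ?v"
    by (metis norm_eq_sqrt_inner real_sqrt_abs real_sqrt_mult)
  then have "collinear {0, ?u, ?v}"
    by (simp add: norm_cauchy_schwarz_equal)
  then have "collinear {Y, X, Z}"
    by (subst collinear_3) simp_all
  then show ?thesis by (simp add: insert_commute)
qed

text \<open>
  In barycentric coordinates with respect to \<open>A, B, C\<close> the three points are
  \<open>(0, 1 - r, r)\<close>, \<open>(s, 0, 1 - s)\<close> and \<open>(1 - t, t, 0)\<close>; the factor on the right is the
  determinant of these rows.
\<close>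

lemma signed_area_points_on_sides:
  fixes A B C :: "real^2" and r s t :: real
  shows "signed_area (B + r *\<^sub>R (C - B)) (C + s *\<^sub>R (A - C)) (A + t *\<^sub>R (B - A)) =
           (r * s * t + (1 - r) * (1 - s) * (1 - t)) * signed_area A B C"
  unfolding signed_area_eq_det by (simp add: det_2 field_simps)

lemma has_integral_power_mult_power_unit_interval:
  fixes k m :: nat
  shows "((\<lambda>x::real. x ^ k * (1 - x) ^ m) has_integral
           (fact k * fact m / fact (k + m + 1))) {0..1}"
proof -
  have "((\<lambda>x::real. x powr (real (Suc k) - 1) * (1 - x) powr (real (Suc m) - 1)) has_integral
           Beta (real (Suc k)) (real (Suc m))) {0..1}"
    by (rule has_integral_Beta_real) auto
  moreover have "Beta (real (Suc k)) (real (Suc m)) = fact k * fact m / fact (k + m + 1)"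
    using Gamma_fact[of k, where 'a = real] Gamma_fact[of m, where 'a = real]
      Gamma_fact[of "k + m + 1", where 'a = real]
    by (simp add: Beta_def add_ac)
  ultimately have "((\<lambda>x::real. x powr (real (Suc k) - 1) * (1 - x) powr (real (Suc m) - 1))
      has_integral (fact k * fact m / fact (k + m + 1))) {0..1}"
    by simp
  \<comment> \<open>The endpoints must be left out: \<open>0 powr 0 = 0\<close> whereas \<open>0 ^ 0 = 1\<close>.\<close>
  then show ?thesis
    by (rule has_integral_spike_finite[of "{0, 1}", rotated 2])
       (auto simp: powr_realpow)
qed

lemma moment_uniform_01:
  fixes X :: "'a \<Rightarrow> real" and k m :: nat
  assumes [measurable]: "X \<in> borel_measurable M"
    and unif: "distr M borel X = uniform_measure lborel {0..1}"
  shows "integrable M (\<lambda>\<omega>. X \<omega> ^ k * (1 - X \<omega>) ^ m)"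
    and "(\<integral>\<omega>. X \<omega> ^ k * (1 - X \<omega>) ^ m \<partial>M) = fact k * fact m / fact (k + m + 1)"
proof -
  let ?f = "\<lambda>x::real. x ^ k * (1 - x) ^ m"
  have density: "uniform_measure lborel {0..1::real} = density lborel (\<lambda>x. ennreal (indicator {0..1} x))"
    by (simp add: uniform_measure_def divide_ennreal_def ennreal_indicator)
  have int: "set_integrable lborel {0..1} ?f"
    by (rule borel_integrable_atLeastAtMost') (intro continuous_intros)
  have "(LINT x:{0..1}|lborel. ?f x) = fact k * fact m / fact (k + m + 1)"
    using set_borel_integral_eq_integral(2)[OF int] has_integral_power_mult_power_unit_interval[of k m]
    by (simp add: integral_unique)
  then have *: "(\<integral>x. ?f x \<partial>distr M borel X) = fact k * fact m / fact (k + m + 1)"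
    unfolding unif density set_lebesgue_integral_def by (subst integral_density) auto
  have "integrable (distr M borel X) ?f"
    using int unfolding unif density set_integrable_def by (subst integrable_density) auto
  then show "integrable M (\<lambda>\<omega>. ?f (X \<omega>))"
    by (subst (asm) integrable_distr_eq) auto
  show "(\<integral>\<omega>. ?f (X \<omega>) \<partial>M) = fact k * fact m / fact (k + m + 1)"
    using * by (subst (asm) integral_distr) auto
qed

theorem mainTheorem2:
  fixes A B C :: "real^2"
    and M :: "'a measure"
    and r s t :: "'a \<Rightarrow> real"
    and R S T :: "'a \<Rightarrow> real^2"
    and Q :: "'a \<Rightarrow> real"
    and n :: nat
  assumes triangle: "\<not> collinear {A, B, C}"
    and prob: "prob_space M"
    and indep: "prob_space.indep_vars M (\<lambda>_. borel) (\<lambda>i. [r, s, t] ! i) {..<3}"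
    and unif_r: "distr M borel r = uniform_measure lborel {0..1}"
    and unif_s: "distr M borel s = uniform_measure lborel {0..1}"
    and unif_t: "distr M borel t = uniform_measure lborel {0..1}"
    and R: "R = (\<lambda>\<omega>. B + r \<omega> *\<^sub>R (C - B))"
    and S: "S = (\<lambda>\<omega>. C + s \<omega> *\<^sub>R (A - C))"
    and T: "T = (\<lambda>\<omega>. A + t \<omega> *\<^sub>R (B - A))"
    and Q: "Q = (\<lambda>\<omega>. signed_area (R \<omega>) (S \<omega>) (T \<omega>) / signed_area A B C)"
    and n: "n \<ge> 1"
  shows "(\<integral>\<omega>. Q \<omega> ^ n \<partial>M) =
           (\<Sum>k=0..n. fact n / (fact k * fact (n - k)) * ((fact (n - k) * fact k) / fact (n + 1)) ^ 3)
       \<and> (\<integral>\<omega>. Q \<omega> ^ n \<partial>M) =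
           1 / ((real n + 1) * (fact (n + 1))\<^sup>2) * (\<Sum>k=0..n. (fact (n - k))\<^sup>2 * (fact k)\<^sup>2)
       \<and> (\<integral>\<omega>. signed_area (R \<omega>) (S \<omega>) (T \<omega>) ^ n \<partial>M) =
           (\<integral>\<omega>. Q \<omega> ^ n \<partial>M) * signed_area A B C ^ n"
proof -
  interpret prob_space M by (fact prob)
  let ?X = "\<lambda>i. [r, s, t] ! i"
  let ?p = "\<lambda>k x :: real. x ^ k * (1 - x) ^ (n - k)"
  let ?P = "\<lambda>k \<omega>. \<Prod>i<3. ?p k (?X i \<omega>)"
  have area_nz: "signed_area A B C \<noteq> 0"
    using triangle det_eq_0_imp_collinear[of B A C] by (auto simp: signed_area_eq_det)
  have area: "signed_area (R \<omega>) (S \<omega>) (T \<omega>) = Q \<omega> * signed_area A B C" for \<omega>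
    using area_nz by (simp add: Q)
  have Q_eq: "Q \<omega> = r \<omega> * s \<omega> * t \<omega> + (1 - r \<omega>) * (1 - s \<omega>) * (1 - t \<omega>)" for \<omega>
    using area_nz by (simp add: Q R S T signed_area_points_on_sides)
  have Q_power: "Q \<omega> ^ n = (\<Sum>k=0..n. real (n choose k) * ?P k \<omega>)" for \<omega>
    unfolding Q_eq binomial_ring atLeast0AtMost
    by (intro sum.cong refl) (simp add: eval_nat_numeral power_mult_distrib mult_ac)

  have moment: "integrable M (\<lambda>\<omega>. ?p k (?X i \<omega>)) \<and>
      (\<integral>\<omega>. ?p k (?X i \<omega>) \<partial>M) = fact k * fact (n - k) / fact (n + 1)"
    if "i < 3" "k \<le> n" for i k
  proof -
    have "random_variable borel (?X i)"
      using indep that unfolding indep_vars_def by auto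
    moreover have "distr M borel (?X i) = uniform_measure lborel {0..1}"
      using that unif_r unif_s unif_t by (auto simp: less_Suc_eq eval_nat_numeral)
    ultimately show ?thesis
      using moment_uniform_01[of "?X i" M k "n - k"] that by simp
  qed
  have indep_p: "indep_vars (\<lambda>_. borel) (\<lambda>i \<omega>. ?p k (?X i \<omega>)) {..<3}" for k
    by (rule indep_vars_compose2[OF indep]) auto
  have P_int: "integrable M (?P k)" if "k \<le> n" for k
    by (rule indep_vars_integrable[OF _ indep_p]) (use moment that in auto)
  have P_mean: "(\<integral>\<omega>. ?P k \<omega> \<partial>M) = (fact (n - k) * fact k / fact (n + 1)) ^ 3"
    if "k \<le> n" for k
  proof -
    have "(\<integral>\<omega>. ?P k \<omega> \<partial>M) = (\<Prod>i<3. \<integral>\<omega>. ?p k (?X i \<omega>) \<partial>M)"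
      by (rule indep_vars_lebesgue_integral[OF _ indep_p]) (use moment that in auto)
    also have "\<dots> = (\<Prod>i<(3::nat). fact (n - k) * fact k / fact (n + 1))"
      by (rule prod.cong) (use moment that in \<open>auto simp: mult.commute\<close>)
    finally show ?thesis by simp
  qed
  have mean: "(\<integral>\<omega>. Q \<omega> ^ n \<partial>M) =
      (\<Sum>k=0..n. fact n / (fact k * fact (n - k)) * ((fact (n - k) * fact k) / fact (n + 1)) ^ 3)"
  proof -
    have "(\<integral>\<omega>. Q \<omega> ^ n \<partial>M) = (\<Sum>k=0..n. \<integral>\<omega>. real (n choose k) * ?P k \<omega> \<partial>M)"
      unfolding Q_power by (rule Bochner_Integration.integral_sum) (use P_int in auto)
    also have "\<dots> = (\<Sum>k=0..n. real (n choose k) * ((fact (n - k) * fact k) / fact (n + 1)) ^ 3)"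
      by (intro sum.cong refl) (simp only: integral_mult_right_zero P_mean atLeastAtMost_iff)
    finally show ?thesis by (simp add: binomial_fact)
  qed
  have summand: "fact n / (fact k * fact (n - k)) * ((fact (n - k) * fact k) / fact (n + 1)) ^ 3 =
      1 / ((real n + 1) * (fact (n + 1))\<^sup>2) * ((fact (n - k))\<^sup>2 * (fact k)\<^sup>2)" for k
  proof -
    have "x / (a * b) * (b * a / (y * x)) ^ 3 = 1 / (y * (y * x)\<^sup>2) * (b\<^sup>2 * a\<^sup>2)"
      if "x \<noteq> 0" "y \<noteq> 0" "a \<noteq> 0" "b \<noteq> 0" for x y a b :: real
      using that by (simp add: field_simps power2_eq_square power3_eq_cube)
    from this[of "fact n" "real n + 1" "fact k" "fact (n - k)"] show ?thesis
      by (simp add: add.commute)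
  qed
  show ?thesis
  proof (intro conjI)
    show "(\<integral>\<omega>. Q \<omega> ^ n \<partial>M) =
        1 / ((real n + 1) * (fact (n + 1))\<^sup>2) * (\<Sum>k=0..n. (fact (n - k))\<^sup>2 * (fact k)\<^sup>2)"
      unfolding mean summand sum_distrib_left ..
    show "(\<integral>\<omega>. signed_area (R \<omega>) (S \<omega>) (T \<omega>) ^ n \<partial>M) =
        (\<integral>\<omega>. Q \<omega> ^ n \<partial>M) * signed_area A B C ^ n"
      by (simp add: area power_mult_distrib)
  qed (fact mean)
qed

end
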